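(* Let $\epsilon>0$, $p\ge 1$, and let $\mathcal X\subseteq\mathbb R^n$ be any closed convex set. Let $F:\mathcal X\to\mathbb R^n$ be a monotone, continuous operator that is $p$th-order $L_p$-smooth with respect to an arbitrary norm $\|\cdot\|$. Let $\omega(\cdot,\cdot)$ denote the Bregman divergence of a function $d$ that is strongly convex with respect to the same norm $\|\cdot\|$. Then the procedure MVI-OPT (defined in the context), started at $\mathbf x_0\in\mathcal X$, returns $\hat{\mathbf x}$ such that for all $\mathbf x\in\mathcal X$, $$\langle F(\mathbf x),\hat{\mathbf x}-\mathbf x\rangle\le\epsilon,$$ in at most $$\frac{16}{15}\left(\frac{2L_p}{p!}\right)^{\frac{2}{p+1}}\frac{\omega(\mathbf x,\mathbf x_0)}{\epsilon^{2/(p+1)}}$$ calls to an oracle that solves the subproblem defined in the context.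
   Context: $\|\cdot\|_*$ is the dual norm of $\|\cdot\|$. An operator $F:\mathcal X\to\mathbb R^n$ is monotone if $\langle F(\mathbf x)-F(\mathbf y),\mathbf x-\mathbf y\rangle\ge 0$ for all $\mathbf x,\mathbf y\in\mathcal X$. Taylor expansion: $\mathcal T_k(\mathbf y;\mathbf x)=\sum_{i=0}^{k}\frac1{i!}\nabla^iF(\mathbf x)[\mathbf y-\mathbf x]^i$, where $\nabla^iF(\mathbf x)[\mathbf h]^i$ is the $i$th directional derivative of $F$ at $\mathbf x$ along $\mathbf h$ (a vector in $\mathbb R^n$), and $\nabla^iF(\mathbf x)[\mathbf h]^{i+1}$ is the scalar obtained by contracting it once more with $\mathbf h$. For $p\ge1$, $F$ is $p$th-order $L_p$-smooth with respect to $\|\cdot\|$ if for all $\mathbf x,\mathbf y\in\mathcal X$, $\|\nabla^{p-1}F(\mathbf y)-\nabla^{p-1}F(\mathbf x)\|_*\le L_p\|\mathbf y-\mathbf x\|$, or $\|F(\mathbf y)-\mathcal T_{p-1}(\mathbf y;\mathbf x)\|_*\le\frac{L_p}{p!}\|\mathbf y-\mathbf x\|^p$; here $\|\nabla^{p-1}F(\mathbf y)-\nabla^{p-1}F(\mathbf x)\|_*=\max_{\|\mathbf h\|\le1}|\nabla^{p-1}F(\mathbf y)[\mathbf h]^p-\nabla^{p-1}F(\mathbf x)[\mathbf h]^p|$. $d:\mathcal X\to\mathbb R$ is strongly convex with respect to $\|\cdot\|$ in the normalization $d(\mathbf x)-d(\mathbf y)-\langle\nabla d(\mathbf y),\mathbf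 x-\mathbf y\rangle\ge\|\mathbf x-\mathbf y\|^2$; its Bregman divergence is $\omega(\mathbf x,\mathbf y)=d(\mathbf x)-d(\mathbf y)-\langle\nabla d(\mathbf y),\mathbf x-\mathbf y\rangle$. Subproblem oracle: for any $\hat{\mathbf x}\in\mathcal X$ the oracle finds $T(\hat{\mathbf x})\in\mathcal X$ with $\langle U_{p,\hat{\mathbf x}}(T(\hat{\mathbf x})),T(\hat{\mathbf x})-\mathbf x\rangle\le 0$ for all $\mathbf x\in\mathcal X$, where $$U_{p,\mathbf x}(\mathbf y)=\mathcal T_{p-1}(\mathbf y;\mathbf x)+\frac{2L_p}{p!}\,\omega(\mathbf y,\mathbf x)^{\frac{p-1}{2}}\big(\nabla d(\mathbf y)-\nabla d(\mathbf x)\big).$$ Procedure MVI-OPT$(\mathbf x_0\in\mathcal X,K,p)$: for $i=0,1,\dots,K$ set $\mathbf x_{i+\frac12}=T(\mathbf x_i)$; $\lambda_i=\frac12\,\omega(\mathbf x_{i+\frac12},\mathbf x_i)^{-\frac{p-1}{2}}$; $\mathbf x_{i+1}=\arg\min_{\mathbf x\in\mathcal X}\{\langle F(\mathbf x_{i+\frac12}),\mathbf x-\mathbf x_{i+\frac12}\rangle+\frac{L_p}{p!\lambda_i}\omega(\mathbf x,\mathbf x_i)\}$. Return $\hat{\mathbf x}_K=\big(\sum_{i=0}^K\lambda_i\mathbf x_{i+\frac12}\big)/\sum_{i=0}^K\lambda_i$, which is the point $\hat{\mathbf x}$ of the claim.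
   Formalization: Smoothness is taken only in its Taylor-remainder form: under the alternative bound on the derivative difference contracted with h p times, the claim fails (e.g. p=20 in the plane). Also L_p>0 is assumed, and if λ_i is infinite the procedure stops and returns T(x_i). *)

theory Defs
  imports "HOL-Analysis.Analysis"
begin

definition is_norm :: "('a::real_vector \<Rightarrow> real) \<Rightarrow> bool" where
  "is_norm N \<longleftrightarrow>
     (\<forall>x. N x = 0 \<longleftrightarrow> x = 0) \<and>
     (\<forall>c x. N (c *\<^sub>R x) = \<bar>c\<bar> * N x) \<and>
     (\<forall>x y. N (x + y) \<le> N x + N y)"

definition dual_norm :: "('a::real_inner \<Rightarrow> real) \<Rightarrow> 'a \<Rightarrow> real" where
  "dual_norm N y = (SUP h\<in>{h. N h \<le> 1}. y \<bullet> h)"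

definition monotone_operator :: "'a::real_inner set \<Rightarrow> ('a \<Rightarrow> 'a) \<Rightarrow> bool" where
  "monotone_operator X F \<longleftrightarrow> (\<forall>x\<in>X. \<forall>y\<in>X. (F x - F y) \<bullet> (x - y) \<ge> 0)"

(* dir_deriv X F i x h is the i-th derivative at t = 0 of t \<mapsto> F (x + t h), taken within
   {t. x + t h \<in> X}, so that only values of F on X enter; it is one-sided where the line
   leaves X at x, and the ordinary directional derivative at interior points. *)
primrec dir_deriv ::
  "'a::real_normed_vector set \<Rightarrow> ('a \<Rightarrow> 'a) \<Rightarrow> nat \<Rightarrow> 'a \<Rightarrow> 'a \<Rightarrow> 'a" where
  "dir_deriv X F 0 x h = F x"
| "dir_deriv X F (Suc i) x h =
     vector_derivative (\<lambda>t. dir_deriv X F i (x + t *\<^sub>R h) h) (at 0 within {t. x + t *\<^sub>R h \<in> X})"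

definition dir_differentiable ::
  "'a::real_normed_vector set \<Rightarrow> ('a \<Rightarrow> 'a) \<Rightarrow> nat \<Rightarrow> bool" where
  "dir_differentiable X F k \<longleftrightarrow>
     (\<forall>x\<in>X. \<forall>h. \<forall>i<k. (\<lambda>t. dir_deriv X F i (x + t *\<^sub>R h) h)
        differentiable (at 0 within {t. x + t *\<^sub>R h \<in> X}))"

definition taylor ::
  "'a::real_normed_vector set \<Rightarrow> ('a \<Rightarrow> 'a) \<Rightarrow> nat \<Rightarrow> 'a \<Rightarrow> 'a \<Rightarrow> 'a" where
  "taylor X F k y x = (\<Sum>i\<le>k. (1 / fact i) *\<^sub>R dir_deriv X F i x (y - x))"

(* Smoothness in its Taylor-remainder form. The variant that bounds the dual norm of
   \<nabla>^(p-1) F(y)[h]^(p-1) - \<nabla>^(p-1) F(x)[h]^(p-1) by L N(y - x) for all N h \<le> 1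
   implies it by integration along the segment. The variant that contracts this difference
   with h itself does not, because \<nabla>^(p-1) F need not be symmetric in its output index. *)
definition smooth_operator ::
  "('a::real_inner \<Rightarrow> real) \<Rightarrow> 'a set \<Rightarrow> nat \<Rightarrow> real \<Rightarrow> ('a \<Rightarrow> 'a) \<Rightarrow> bool" where
  "smooth_operator N X p L F \<longleftrightarrow>
     dir_differentiable X F (p - 1) \<and>
     (\<forall>x\<in>X. \<forall>y\<in>X. dual_norm N (F y - taylor X F (p - 1) y x) \<le> L / fact p * N (y - x) ^ p)"

definition bregman :: "('a::real_inner \<Rightarrow> real) \<Rightarrow> ('a \<Rightarrow> 'a) \<Rightarrow> 'a \<Rightarrow> 'a \<Rightarrow> real" where
  "bregman d gd x y = d x - d y - gd y \<bullet> (x - y)"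

(* gd is the gradient of d, relative to X so that boundary points of X are covered.
   If X has empty interior the gradient is not unique and gd is any choice of it. *)
definition strongly_convex ::
  "('a::real_inner \<Rightarrow> real) \<Rightarrow> 'a set \<Rightarrow> ('a \<Rightarrow> real) \<Rightarrow> ('a \<Rightarrow> 'a) \<Rightarrow> bool" where
  "strongly_convex N X d gd \<longleftrightarrow>
     (\<forall>x\<in>X. (d has_derivative (\<lambda>h. gd x \<bullet> h)) (at x within X)) \<and>
     (\<forall>x\<in>X. \<forall>y\<in>X. d x - d y - gd y \<bullet> (x - y) \<ge> N (x - y) ^ 2)"

(* \<omega>(y,x)^((p-1)/2), written as a natural power of the square root: unlike powr, this gives
   the intended value 1 for p = 1 also when \<omega>(y,x) = 0. *)
definition omega_power ::
  "('a::real_inner \<Rightarrow> real) \<Rightarrow> ('a \<Rightarrow> 'a) \<Rightarrow> nat \<Rightarrow> 'a \<Rightarrow> 'a \<Rightarrow> real" where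
  "omega_power d gd p y x = sqrt (bregman d gd y x) ^ (p - 1)"

definition U_op ::
  "'a::real_inner set \<Rightarrow> ('a \<Rightarrow> 'a) \<Rightarrow> ('a \<Rightarrow> real) \<Rightarrow> ('a \<Rightarrow> 'a) \<Rightarrow> real \<Rightarrow> nat \<Rightarrow> 'a \<Rightarrow> 'a \<Rightarrow> 'a"
where
  "U_op X F d gd L p x y =
     taylor X F (p - 1) y x + (2 * L / fact p * omega_power d gd p y x) *\<^sub>R (gd y - gd x)"

definition subproblem_oracle ::
  "'a::real_inner set \<Rightarrow> ('a \<Rightarrow> 'a) \<Rightarrow> ('a \<Rightarrow> real) \<Rightarrow> ('a \<Rightarrow> 'a) \<Rightarrow> real \<Rightarrow> nat \<Rightarrow> ('a \<Rightarrow> 'a) \<Rightarrow> bool"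
where
  "subproblem_oracle X F d gd L p T \<longleftrightarrow>
     (\<forall>z\<in>X. T z \<in> X \<and> (\<forall>x\<in>X. U_op X F d gd L p z (T z) \<bullet> (T z - x) \<le> 0))"

definition mvi_lambda ::
  "('a::real_inner \<Rightarrow> real) \<Rightarrow> ('a \<Rightarrow> 'a) \<Rightarrow> nat \<Rightarrow> ('a \<Rightarrow> 'a) \<Rightarrow> 'a \<Rightarrow> real" where
  "mvi_lambda d gd p T x = 1 / (2 * omega_power d gd p (T x) x)"

(* The weight 1/2 \<omega>(T x, x)^(-(p-1)/2) is infinite. For a strongly convex d this happens
   exactly when p \<ge> 2 and T x = x. The procedure then stops and returns T x, the limit of the
   weighted average as this weight tends to infinity. *)
definition mvi_stops ::
  "('a::real_inner \<Rightarrow> real) \<Rightarrow> ('a \<Rightarrow> 'a) \<Rightarrow> nat \<Rightarrow> ('a \<Rightarrow> 'a) \<Rightarrow> 'a \<Rightarrow> bool" where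
  "mvi_stops d gd p T x \<longleftrightarrow> omega_power d gd p (T x) x = 0"

(* The iterates x_i. A stopped iterate is kept, so mvi_stops holds at index K iff it holds
   at some index i \<le> K. *)
primrec mvi_iterate ::
  "'a::real_inner set \<Rightarrow> ('a \<Rightarrow> 'a) \<Rightarrow> ('a \<Rightarrow> real) \<Rightarrow> ('a \<Rightarrow> 'a) \<Rightarrow> real \<Rightarrow> nat \<Rightarrow> ('a \<Rightarrow> 'a) \<Rightarrow>
   'a \<Rightarrow> nat \<Rightarrow> 'a"
where
  "mvi_iterate X F d gd L p T x0 0 = x0"
| "mvi_iterate X F d gd L p T x0 (Suc i) =
     (let x = mvi_iterate X F d gd L p T x0 i in
      if mvi_stops d gd p T x then x
      else arg_min
             (\<lambda>z. F (T x) \<bullet> (z - T x) + L / (fact p * mvi_lambda d gd p T x) * bregman d gd z x)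
             (\<lambda>z. z \<in> X))"

(* The point returned after the loop i = 0, ..., K, which calls the oracle T once for each i
   (K + 1 calls, or fewer if the procedure stops early). *)
definition mvi_opt ::
  "'a::real_inner set \<Rightarrow> ('a \<Rightarrow> 'a) \<Rightarrow> ('a \<Rightarrow> real) \<Rightarrow> ('a \<Rightarrow> 'a) \<Rightarrow> real \<Rightarrow> nat \<Rightarrow> ('a \<Rightarrow> 'a) \<Rightarrow>
   'a \<Rightarrow> nat \<Rightarrow> 'a"
where
  "mvi_opt X F d gd L p T x0 K =
     (let x = mvi_iterate X F d gd L p T x0; l = (\<lambda>i. mvi_lambda d gd p T (x i)) in
      if mvi_stops d gd p T (x K) then T (x K)
      else (1 / (\<Sum>i\<le>K. l i)) *\<^sub>R (\<Sum>i\<le>K. l i *\<^sub>R T (x i)))"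

end

theory Submission
  imports Defs
begin

text \<open>Write \<open>h = T x\<close> and let \<open>z\<close> be the iterate after \<open>x\<close>. In
  \<open>\<langle>F h, h - y\<rangle> = \<langle>F h, z - y\<rangle> + \<langle>G, h - z\<rangle> + \<langle>F h - G, h - z\<rangle>\<close>, with \<open>G\<close> the Taylor
  polynomial at \<open>h\<close>, the optimality conditions of the two subproblems and the three-point identity
  control the first two terms. The choice of \<open>\<lambda>\<close> makes the Taylor error at most
  \<open>(L / p!) \<omega>(h, x)\<^sup>1\<^sup>/\<^sup>2 \<omega>(z, h)\<^sup>1\<^sup>/\<^sup>2 / 2\<close>, which is absorbed up to \<open>\<omega>(h, x) / 16\<close>. Telescoping
  leaves \<open>\<omega>(y, x0) - 15/16 \<Sum> \<omega>(h, x)\<close>: either this is nonpositive, or the \<open>\<omega>(h, x)\<close> are small on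
  average and convexity of \<open>\<omega> \<mapsto> \<omega>\<^sup>-\<^sup>(\<^sup>p\<^sup>-\<^sup>1\<^sup>)\<^sup>/\<^sup>2\<close> makes the total weight large.\<close>

section \<open>Arbitrary norms and their duals on a Euclidean space\<close>

lemma is_norm_zero: "is_norm N \<Longrightarrow> N 0 = 0"
  unfolding is_norm_def by blast

lemma is_norm_scale: "is_norm N \<Longrightarrow> N (c *\<^sub>R x) = \<bar>c\<bar> * N x"
  unfolding is_norm_def by blast

lemma is_norm_minus: "is_norm N \<Longrightarrow> N (- x) = N x"
  using is_norm_scale[of N "- 1" x] by simp

lemma is_norm_triangle: "is_norm N \<Longrightarrow> N (x + y) \<le> N x + N y"
  unfolding is_norm_def by blast

lemma is_norm_nonneg:
  assumes "is_norm N" shows "0 \<le> N x"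
  using is_norm_triangle[OF assms, of x "- x"] is_norm_minus[OF assms, of x]
    is_norm_zero[OF assms] by simp

lemma is_norm_pos: "is_norm N \<Longrightarrow> x \<noteq> 0 \<Longrightarrow> 0 < N x"
  by (metis is_norm_def is_norm_nonneg order_le_less)

text \<open>Expanding in the basis bounds \<open>N\<close> above by a multiple of the Euclidean
  norm, so \<open>N\<close> is Lipschitz and attains its minimum on the unit sphere. That minimum is
  positive by definiteness, and homogeneity makes it the constant \<open>c\<close>.\<close>

lemma is_norm_bounds_norm:
  fixes N :: "'a::euclidean_space \<Rightarrow> real"
  assumes N: "is_norm N"
  obtains c where "c > 0" "\<And>x. c * norm x \<le> N x"
proof (cases "\<exists>x::'a. norm x = 1")
  case True
  define M where "M = (\<Sum>b\<in>(Basis::'a set). N b)"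
  have sum_le: "N (\<Sum>b\<in>B. f b) \<le> (\<Sum>b\<in>B. N (f b))" if "finite B" for B :: "'a set" and f
    using that
    by induction (auto simp: is_norm_zero[OF N] intro: order_trans[OF is_norm_triangle[OF N]])
  have le: "N x \<le> M * norm x" for x
  proof -
    have "N x = N (\<Sum>b\<in>Basis. (x \<bullet> b) *\<^sub>R b)"
      by (simp add: euclidean_representation)
    also have "\<dots> \<le> (\<Sum>b\<in>Basis. \<bar>x \<bullet> b\<bar> * N b)"
      using sum_le[of Basis "\<lambda>b. (x \<bullet> b) *\<^sub>R b"] by (simp add: is_norm_scale[OF N])
    also have "\<dots> \<le> (\<Sum>b\<in>Basis. norm x * N b)"
      by (intro sum_mono mult_right_mono Basis_le_norm is_norm_nonneg[OF N])
    finally show ?thesis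
      by (simp add: M_def sum_distrib_left mult.commute)
  qed
  have "M \<ge> 0"
    unfolding M_def by (intro sum_nonneg is_norm_nonneg[OF N])
  have lip: "\<bar>N x - N y\<bar> \<le> M * dist x y" for x y
    using is_norm_triangle[OF N, of "x - y" y] is_norm_triangle[OF N, of "y - x" x]
      le[of "x - y"] le[of "y - x"] by (simp add: dist_norm norm_minus_commute)
  have "M-lipschitz_on (sphere 0 1) N"
    using \<open>M \<ge> 0\<close> lip by (intro lipschitz_onI) (auto simp: dist_real_def)
  then have "continuous_on (sphere 0 1) N"
    by (rule lipschitz_on_continuous_on)
  moreover have "sphere (0::'a) 1 \<noteq> {}"
    using True by auto
  ultimately obtain u where u: "u \<in> sphere 0 1" "\<And>x. x \<in> sphere 0 1 \<Longrightarrow> N u \<le> N x"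
    using continuous_attains_inf[OF compact_sphere, of "0::'a" 1 N] by blast
  have "u \<noteq> 0"
    using u(1) by auto
  have "N u * norm x \<le> N x" for x
  proof (cases "x = 0")
    case False
    then have "N u \<le> N ((1 / norm x) *\<^sub>R x)"
      by (intro u(2)) simp
    then show ?thesis
      using False by (simp add: is_norm_scale[OF N] field_simps)
  qed (simp add: is_norm_zero[OF N])
  then show ?thesis
    using is_norm_pos[OF N \<open>u \<noteq> 0\<close>] that by blast
next
  case False
  \<comment> \<open>A nonzero \<open>x\<close> would yield the unit vector
    \<open>sgn x\<close>.\<close>
  then have "x = 0" for x :: 'a
    by (metis norm_sgn)
  then have "1 * norm x \<le> N x" for x
    by (metis is_norm_nonneg[OF N] mult_1 norm_zero)
  then show ?thesis
    using that zero_less_one by blast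
qed

text \<open>The supremum in \<open>dual_norm\<close> is informative only over a set that is bounded
  above. The \<open>N\<close>-unit ball is Euclidean-bounded because \<open>N\<close> dominates a
  multiple of \<open>norm\<close>, so Cauchy-Schwarz gives the bound; the rest is scaling
  \<open>v\<close> to \<open>N\<close>-length 1.\<close>

lemma inner_le_dual_norm:
  fixes N :: "'a::euclidean_space \<Rightarrow> real"
  assumes N: "is_norm N"
  shows "u \<bullet> v \<le> dual_norm N u * N v"
proof (cases "v = 0")
  case False
  obtain c where c: "c > 0" "\<And>x. c * norm x \<le> N x"
    using is_norm_bounds_norm[OF N] by blast
  have bdd: "bdd_above ((\<lambda>h. u \<bullet> h) ` {h. N h \<le> 1})"
  proof (rule bdd_aboveI2)
    fix h assume "h \<in> {h. N h \<le> 1}"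
    then have "norm h \<le> 1 / c"
      using c(2)[of h] c(1) by (simp add: field_simps)
    then show "u \<bullet> h \<le> norm u * (1 / c)"
      using norm_cauchy_schwarz[of u h] mult_left_mono[of "norm h" "1 / c" "norm u"] by simp
  qed
  have pos: "N v > 0"
    by (rule is_norm_pos[OF N False])
  have "u \<bullet> ((1 / N v) *\<^sub>R v) \<le> dual_norm N u"
    unfolding dual_norm_def
    by (rule cSUP_upper[OF _ bdd]) (use pos in \<open>simp add: is_norm_scale[OF N]\<close>)
  then show ?thesis
    using pos by (simp add: field_simps)
qed (simp add: is_norm_zero[OF N])

section \<open>Bregman divergences\<close>

text \<open>Turns the gradient differences in the optimality conditions of both subproblems into
  divergences that cancel or telescope.\<close>

lemma bregman_three_point:
  "(gd y - gd z) \<bullet> (x - y) = bregman d gd x z - bregman d gd x y - bregman d gd y z"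
  unfolding bregman_def by (simp add: algebra_simps inner_diff_left inner_diff_right)

lemma bregman_self: "bregman d gd x x = 0"
  unfolding bregman_def by simp

lemma bregman_ge:
  assumes "strongly_convex N X d gd" "x \<in> X" "y \<in> X"
  shows "N (x - y) ^ 2 \<le> bregman d gd x y"
  using assms unfolding strongly_convex_def bregman_def by blast

lemma bregman_nonneg:
  assumes "strongly_convex N X d gd" "x \<in> X" "y \<in> X"
  shows "0 \<le> bregman d gd x y"
  using bregman_ge[OF assms] zero_le_power2 order_trans by blast

lemma norm_le_sqrt_bregman:
  assumes "strongly_convex N X d gd" "x \<in> X" "y \<in> X"
  shows "N (x - y) \<le> sqrt (bregman d gd x y)"
  by (rule real_le_rsqrt[OF bregman_ge[OF assms]])

section \<open>First-order optimality and the proximal step\<close>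

text \<open>By convexity the segment from \<open>z\<close> to \<open>y\<close> stays in
  \<open>X\<close>, so a derivative relative to \<open>X\<close> restricts to a one-sided derivative
  along it. If that were negative, points of the segment close to \<open>z\<close> would have a
  smaller value.\<close>

lemma derivative_nonneg_at_min:
  fixes f :: "'a::real_normed_vector \<Rightarrow> real"
  assumes f': "(f has_derivative f') (at z within X)"
    and "convex X" "z \<in> X" "y \<in> X" and min: "\<And>w. w \<in> X \<Longrightarrow> f z \<le> f w"
  shows "0 \<le> f' (y - z)"
proof (rule ccontr)
  assume neg: "\<not> 0 \<le> f' (y - z)"
  define g where "g t = z + t *\<^sub>R (y - z)" for t :: real
  have g_in: "g t \<in> X" if "t \<in> {0..1}" for t
  proof -
    have "g t = (1 - t) *\<^sub>R z + t *\<^sub>R y"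
      by (simp add: g_def algebra_simps)
    then show ?thesis
      using that assms(2-4) by (simp add: convexD)
  qed
  have "(g has_derivative (\<lambda>t. t *\<^sub>R (y - z))) (at 0 within {0..1})"
    unfolding g_def by (auto intro!: derivative_eq_intros)
  moreover have "(f has_derivative f') (at (g 0) within g ` {0..1})"
    by (rule has_derivative_subset[where s = X]) (use f' g_in in \<open>auto simp: g_def\<close>)
  ultimately have "((\<lambda>t. f (g t)) has_derivative (\<lambda>t. f' (t *\<^sub>R (y - z)))) (at 0 within {0..1})"
    by (rule has_derivative_in_compose)
  moreover have "f' (t *\<^sub>R (y - z)) = t * f' (y - z)" for t
    using linear_cmul[OF has_derivative_linear[OF f']] by simp
  ultimately have "((\<lambda>t. f (g t)) has_real_derivative f' (y - z)) (at 0 within {0..1})"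
    by (simp add: has_field_derivative_def mult_commute_abs)
  from has_real_derivative_neg_dec_right[OF this] neg
  obtain e where e: "e > 0" "\<And>h. h > 0 \<Longrightarrow> h \<in> {0..1} \<Longrightarrow> h < e \<Longrightarrow> f (g 0) > f (g h)"
    by auto
  define h where "h = min 1 (e / 2)"
  have h: "h > 0" "h \<in> {0..1}" "h < e"
    using e(1) by (auto simp: h_def)
  show False
    using e(2)[OF h] min[OF g_in[OF h(2)]] by (simp add: g_def)
qed

lemma prox_minimizer_exists:
  fixes N :: "'a::euclidean_space \<Rightarrow> real"
  assumes N: "is_norm N" and sc: "strongly_convex N X d gd" and "closed X" "x \<in> X" "c > 0"
  shows "\<exists>z\<in>X. \<forall>w\<in>X. a \<bullet> (z - y) + c * bregman d gd z x \<le> a \<bullet> (w - y) + c * bregman d gd w x"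
proof -
  define f where "f z = a \<bullet> (z - y) + c * bregman d gd z x" for z
  obtain k where k: "k > 0" "\<And>x. k * norm x \<le> N x"
    using is_norm_bounds_norm[OF N] by blast
  \<comment> \<open>The radius \<open>r\<close> at which the lower bound
    \<open>c * k^2 * r^2\<close> of the divergence term catches up with the largest decrease
    \<open>norm a * r\<close> of the linear term.\<close>
  define R where "R = norm a / (c * k\<^sup>2)"
  have "R \<ge> 0"
    using \<open>c > 0\<close> k by (simp add: R_def)
  \<comment> \<open>outside this ball the quadratic growth of the divergence beats the linear term\<close>
  have far: "f x \<le> f w" if "w \<in> X" "w \<notin> cball x R" for w
  proof -
    have "R < norm (w - x)"
      using that by (simp add: dist_norm norm_minus_commute)
    then have "norm a * norm (w - x) \<le> c * k\<^sup>2 * norm (w - x) * norm (w - x)"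
      using \<open>c > 0\<close> k by (intro mult_right_mono) (auto simp: R_def field_simps)
    also have "\<dots> = c * (k * norm (w - x))\<^sup>2"
      by (simp add: power2_eq_square)
    also have "\<dots> \<le> c * (N (w - x))\<^sup>2"
      using \<open>c > 0\<close> k by (intro mult_left_mono power_mono) auto
    also have "\<dots> \<le> c * bregman d gd w x"
      using bregman_ge[OF sc that(1) \<open>x \<in> X\<close>] \<open>c > 0\<close> by simp
    finally have "norm a * norm (w - x) \<le> c * bregman d gd w x" .
    moreover have "- (a \<bullet> (w - x)) \<le> norm a * norm (w - x)"
      using norm_cauchy_schwarz[of "- a" "w - x"] by simp
    ultimately show ?thesis
      by (simp add: f_def bregman_self inner_diff_right)
  qed
  have "continuous_on X d"
    using sc unfolding strongly_convex_def
    by (meson has_derivative_continuous continuous_on_eq_continuous_within)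
  then have "continuous_on (X \<inter> cball x R) f"
    unfolding f_def bregman_def by (auto intro!: continuous_intros intro: continuous_on_subset)
  moreover have "compact (X \<inter> cball x R)"
    using \<open>closed X\<close> by (intro closed_Int_compact) auto
  moreover have "x \<in> X \<inter> cball x R"
    using \<open>x \<in> X\<close> \<open>R \<ge> 0\<close> by simp
  ultimately obtain z where z: "z \<in> X" "\<And>w. w \<in> X \<inter> cball x R \<Longrightarrow> f z \<le> f w"
    using continuous_attains_inf[of "X \<inter> cball x R" f] by blast
  have "f z \<le> f w" if "w \<in> X" for w
    using z(2)[of w] z(2)[OF \<open>x \<in> X \<inter> cball x R\<close>] far[OF that] that by force
  then show ?thesis
    using z(1) unfolding f_def by blast
qed

text \<open>First-order optimality at the minimizer reads \<open>a \<bullet> (z - w) \<le> c * ((gd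
  z - gd x) \<bullet> (w - z))\<close>, and the three-point identity rewrites the right-hand
  side.\<close>

lemma prox_inequality:
  fixes X :: "'a::euclidean_space set" and a y :: 'a
  assumes "is_norm N" and sc: "strongly_convex N X d gd" and "closed X" "convex X" "x \<in> X" "c > 0"
  defines "z \<equiv> arg_min (\<lambda>z. a \<bullet> (z - y) + c * bregman d gd z x) (\<lambda>z. z \<in> X)"
  shows "z \<in> X"
    and "w \<in> X \<Longrightarrow>
      a \<bullet> (z - w) \<le> c * (bregman d gd w x - bregman d gd w z - bregman d gd z x)"
proof -
  let ?f = "\<lambda>z. a \<bullet> (z - y) + c * bregman d gd z x"
  obtain z0 where "is_arg_min ?f (\<lambda>z. z \<in> X) z0"
    using prox_minimizer_exists[OF assms(1,2,3,5,6), of a y]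
    by (auto simp: is_arg_min_linorder)
  \<comment> \<open>\<open>arg_min\<close> is a choice operator: its value is known to be a
    minimizer only because some minimizer exists.\<close>
  then have "is_arg_min ?f (\<lambda>z. z \<in> X) z"
    unfolding z_def arg_min_def by (rule someI)
  then have z: "z \<in> X" "\<And>w. w \<in> X \<Longrightarrow> ?f z \<le> ?f w"
    by (auto simp: is_arg_min_linorder)
  show "z \<in> X"
    by fact
  assume w: "w \<in> X"
  have "(d has_derivative (\<lambda>h. gd z \<bullet> h)) (at z within X)"
    using sc z(1) unfolding strongly_convex_def by blast
  then have "(?f has_derivative (\<lambda>h. a \<bullet> h + c * (gd z \<bullet> h - gd x \<bullet> h))) (at z within X)"
    unfolding bregman_def by (auto intro!: derivative_eq_intros simp: inner_diff_right)
  from derivative_nonneg_at_min[OF this \<open>convex X\<close> z(1) w z(2)]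
  have "a \<bullet> (z - w) \<le> c * ((gd z - gd x) \<bullet> (w - z))"
    by (simp add: inner_diff_left inner_diff_right algebra_simps)
  then show "a \<bullet> (z - w) \<le> c * (bregman d gd w x - bregman d gd w z - bregman d gd z x)"
    by (simp only: bregman_three_point[where d = d])
qed

text \<open>In direction 0 the line stays at \<open>x\<close>, so for \<open>x\<close> in
  \<open>X\<close> the parameter set is the whole real line and each higher term differentiates a
  constant.\<close>

lemma taylor_self:
  assumes "x \<in> X"
  shows "taylor X F k x x = F x"
proof -
  have "dir_deriv X F (Suc i) x 0 = 0" for i
    using assms by simp
  then have "taylor X F k x x = (\<Sum>i\<le>k. if i = 0 then F x else 0)"
    unfolding taylor_def by (intro sum.cong) (auto simp: gr0_conv_Suc)
  then show ?thesis
    by simp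
qed

section \<open>Convexity of inverse powers\<close>

text \<open>The tangent at \<open>t\<close> to the convex function that maps \<open>w\<close> to
  \<open>w\<close> to the power \<open>-m/2\<close>. It follows from \<open>ln v \<le> v - 1\<close>
  and \<open>1 + u \<le> exp u\<close>. The last assumption excludes \<open>w = 0\<close> unless
  \<open>m = 0\<close>, when both sides are 1.\<close>

lemma inverse_sqrt_power_ge_tangent:
  fixes w t :: real
  assumes "w \<ge> 0" "t > 0" "sqrt w ^ m \<noteq> 0"
  shows "1 / sqrt w ^ m \<ge> 1 / sqrt t ^ m * (1 - real m / 2 * (w / t - 1))"
proof (cases "m = 0")
  case False
  then have "w \<noteq> 0"
    using assms(3) by (cases m) auto
  then have w: "w > 0"
    using assms(1) by simp
  have root: "sqrt u ^ m = exp (real m / 2 * ln u)" if "u > 0" for u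
  proof -
    have "sqrt u ^ m = exp (ln (sqrt u)) ^ m"
      using that by simp
    also have "\<dots> = exp (real m * ln (sqrt u))"
      by (rule exp_of_nat_mult[symmetric])
    finally show ?thesis
      using that by (simp add: ln_sqrt)
  qed
  have "1 - real m / 2 * (w / t - 1) \<le> 1 + real m / 2 * - ln (w / t)"
    using ln_le_minus_one[of "w / t"] w \<open>t > 0\<close> by (simp add: mult_left_mono)
  also have "\<dots> \<le> exp (real m / 2 * - ln (w / t))"
    by (rule exp_ge_add_one_self)
  also have "\<dots> = sqrt t ^ m / sqrt w ^ m"
    using w \<open>t > 0\<close> by (simp add: root ln_div field_simps flip: exp_diff)
  finally show ?thesis
    using \<open>t > 0\<close> w by (simp add: field_simps)
qed simp

text \<open>Jensen's inequality by summing tangents at \<open>t\<close>. A mean of at most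
  \<open>t\<close> suffices because the tangent slopes downwards.\<close>

lemma sum_inverse_sqrt_power_ge:
  fixes w :: "'i \<Rightarrow> real" and t :: real
  assumes "\<And>i. i \<in> I \<Longrightarrow> w i \<ge> 0" "\<And>i. i \<in> I \<Longrightarrow> sqrt (w i) ^ m \<noteq> 0"
    and "t > 0" "(\<Sum>i\<in>I. w i) \<le> real (card I) * t"
  shows "real (card I) / sqrt t ^ m \<le> (\<Sum>i\<in>I. 1 / sqrt (w i) ^ m)"
proof -
  have "(\<Sum>i\<in>I. w i / t - 1) \<le> 0"
    using assms(3,4) by (simp add: sum_subtractf field_simps flip: sum_divide_distrib)
  then have "real (card I) \<le> real (card I) - real m / 2 * (\<Sum>i\<in>I. w i / t - 1)"
    by (simp add: mult_nonneg_nonpos)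
  also have "\<dots> = (\<Sum>i\<in>I. 1 - real m / 2 * (w i / t - 1))"
    by (simp only: sum_subtractf sum_constant mult_1_right flip: sum_distrib_left)
  finally have "real (card I) / sqrt t ^ m
      \<le> 1 / sqrt t ^ m * (\<Sum>i\<in>I. 1 - real m / 2 * (w i / t - 1))"
    using \<open>t > 0\<close> by (simp add: divide_right_mono)
  also have "\<dots> = (\<Sum>i\<in>I. 1 / sqrt t ^ m * (1 - real m / 2 * (w i / t - 1)))"
    by (rule sum_distrib_left)
  also have "\<dots> \<le> (\<Sum>i\<in>I. 1 / sqrt (w i) ^ m)"
    using assms by (intro sum_mono inverse_sqrt_power_ge_tangent) auto
  finally show ?thesis .
qed

section \<open>One iteration of the procedure\<close>

locale mvi =
  fixes N :: "'a::euclidean_space \<Rightarrow> real" and X :: "'a set"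
    and F T gd :: "'a \<Rightarrow> 'a" and d :: "'a \<Rightarrow> real" and L :: real and p :: nat
  assumes p: "p \<ge> 1" and L: "L > 0" and X: "closed X" "convex X" and N: "is_norm N"
    and mono: "monotone_operator X F" and smooth: "smooth_operator N X p L F"
    and sc: "strongly_convex N X d gd" and T_solves: "subproblem_oracle X F d gd L p T"
begin

abbreviation "\<omega> \<equiv> bregman d gd"

text \<open>The extragradient update: a mirror step from \<open>x\<close> that uses the operator
  value at \<open>T x\<close>.\<close>

definition prox :: "'a \<Rightarrow> 'a" where
  "prox x = arg_min
     (\<lambda>z. F (T x) \<bullet> (z - T x) + L / (fact p * mvi_lambda d gd p T x) * \<omega> z x) (\<lambda>z. z \<in> X)"

lemma T_in: "x \<in> X \<Longrightarrow> T x \<in> X"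
  using T_solves unfolding subproblem_oracle_def by blast

lemma omega_T_nonneg: "x \<in> X \<Longrightarrow> 0 \<le> \<omega> (T x) x"
  by (intro bregman_nonneg[OF sc] T_in)

text \<open>Not stopping keeps the denominator of the weight away from 0, where division would
  return the default weight 0 in place of an infinite one.\<close>

lemma lambda_pos:
  assumes "x \<in> X" "\<not> mvi_stops d gd p T x"
  shows "0 < mvi_lambda d gd p T x"
  using assms(2) omega_T_nonneg[OF assms(1)]
  unfolding mvi_lambda_def mvi_stops_def omega_power_def
  by (simp add: less_le)

lemma prox_in:
  assumes "x \<in> X" "\<not> mvi_stops d gd p T x"
  shows "prox x \<in> X"
  unfolding prox_def
  by (rule prox_inequality(1)[OF N sc X assms(1)]) (use L lambda_pos[OF assms] in simp)

lemma step:
  assumes x: "x \<in> X" and run: "\<not> mvi_stops d gd p T x" and y: "y \<in> X"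
  shows "mvi_lambda d gd p T x * (F y \<bullet> (T x - y))
    \<le> L / fact p * (\<omega> y x - \<omega> y (prox x) - 15 / 16 * \<omega> (T x) x)"
proof -
  define l where "l = mvi_lambda d gd p T x"
  define C where "C = L / fact p"
  define h where "h = T x"
  define z where "z = prox x"
  define s where "s = sqrt (\<omega> h x)"
  define r where "r = sqrt (\<omega> z h)"
  define G where "G = taylor X F (p - 1) h x"
  have l: "l > 0"
    using lambda_pos[OF x run] by (simp add: l_def)
  have C: "C > 0"
    using L by (simp add: C_def)
  have h: "h \<in> X" and z: "z \<in> X"
    using T_in[OF x] prox_in[OF x run] by (simp_all add: h_def z_def)
  \<comment> \<open>The weight is tuned so that \<open>l\<close> times the coefficient
    \<open>2 * C * s ^ (p - 1)\<close> of the subproblem is exactly \<open>C\<close>, the same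
    factor as in \<open>prox_step\<close>.\<close>
  have ls: "2 * l * s ^ (p - 1) = 1"
    using run by (simp add: l_def s_def h_def mvi_lambda_def mvi_stops_def omega_power_def)
  have s2: "s\<^sup>2 = \<omega> h x" and r2: "r\<^sup>2 = \<omega> z h" and s0: "s \<ge> 0" and r0: "r \<ge> 0"
    using bregman_nonneg[OF sc] h x z by (simp_all add: s_def r_def)

  have "F h \<bullet> (z - y) \<le> C / l * (\<omega> y x - \<omega> y z - \<omega> z x)"
    using prox_inequality(2)[OF N sc X x _ y, of "L / (fact p * l)" "F h" h] L l
    by (simp add: z_def prox_def h_def l_def C_def)
  then have prox_step: "l * (F h \<bullet> (z - y)) \<le> C * (\<omega> y x - \<omega> y z - \<omega> z x)"
    using l by (simp add: field_simps)

  \<comment> \<open>The oracle's variational inequality, tested at the next iterate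
    \<open>z\<close>.\<close>
  have "(G + (2 * C * s ^ (p - 1)) *\<^sub>R (gd h - gd x)) \<bullet> (h - z) \<le> 0"
    using T_solves x z unfolding subproblem_oracle_def U_op_def omega_power_def G_def C_def s_def h_def
    by (simp add: mult.assoc)
  then have "G \<bullet> (h - z) \<le> 2 * C * s ^ (p - 1) * ((gd h - gd x) \<bullet> (z - h))"
    by (simp add: inner_diff_right inner_add_left algebra_simps)
  then have "l * (G \<bullet> (h - z)) \<le> l * (2 * C * s ^ (p - 1) * ((gd h - gd x) \<bullet> (z - h)))"
    using l by simp
  also have "\<dots> = (2 * l * s ^ (p - 1)) * (C * ((gd h - gd x) \<bullet> (z - h)))"
    by simp
  also have "\<dots> = C * (\<omega> z x - \<omega> z h - \<omega> h x)"
    by (simp only: ls bregman_three_point[where d = d] mult_1)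
  finally have subproblem_step: "l * (G \<bullet> (h - z)) \<le> C * (\<omega> z x - \<omega> z h - \<omega> h x)" .

  have "(F h - G) \<bullet> (h - z) \<le> dual_norm N (F h - G) * N (h - z)"
    by (rule inner_le_dual_norm[OF N])
  also have "\<dots> \<le> (C * N (h - x) ^ p) * N (h - z)"
    using smooth x h unfolding smooth_operator_def C_def G_def
    by (intro mult_right_mono is_norm_nonneg[OF N]) auto
  also have "\<dots> \<le> (C * s ^ p) * r"
    using norm_le_sqrt_bregman[OF sc h x] norm_le_sqrt_bregman[OF sc z h]
      is_norm_minus[OF N, of "h - z"] C s0
    by (intro mult_mono power_mono mult_left_mono) (auto simp: s_def r_def is_norm_nonneg[OF N])
  finally have "l * ((F h - G) \<bullet> (h - z)) \<le> l * (C * s ^ p * r)"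
    using l by simp
  \<comment> \<open>As \<open>p \<ge> 1\<close>, one factor \<open>s\<close> splits off
    \<open>s ^ p\<close>; the remaining power is cancelled by the weight.\<close>
  also have "\<dots> = (2 * l * s ^ (p - 1)) * (C * (s * r / 2))"
    using p by (cases p) auto
  also have "\<dots> \<le> C * (s\<^sup>2 / 16 + r\<^sup>2)"
  proof -
    \<comment> \<open>Expanding the square of \<open>s / 4 - r\<close>. The split gives
      \<open>r\<close> coefficient 1, which the term \<open>- \<omega> z h\<close> of
      \<open>subproblem_step\<close> absorbs, and leaves \<open>1 - 1 / 16 = 15 / 16\<close> of
      \<open>\<omega> h x\<close>.\<close>
    have "s * r / 2 \<le> s\<^sup>2 / 16 + r\<^sup>2"
      using zero_le_power2[of "s / 4 - r"] by (simp add: power2_eq_square algebra_simps)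
    then show ?thesis
      using C by (simp only: ls mult_1 mult_le_cancel_left_pos)
  qed
  finally have error_step: "l * ((F h - G) \<bullet> (h - z)) \<le> C * (\<omega> h x / 16 + \<omega> z h)"
    by (simp add: s2 r2)

  have "F y \<bullet> (h - y) \<le> F h \<bullet> (h - y)"
    using mono h y unfolding monotone_operator_def by (auto simp: inner_diff_left)
  then have "l * (F y \<bullet> (h - y)) \<le> l * (F h \<bullet> (h - y))"
    using l by simp
  also have "\<dots> = l * (F h \<bullet> (z - y)) + l * (G \<bullet> (h - z)) + l * ((F h - G) \<bullet> (h - z))"
    by (simp add: inner_diff_left inner_diff_right algebra_simps)
  also have "\<dots> \<le> C * (\<omega> y x - \<omega> y z - \<omega> z x) + C * (\<omega> z x - \<omega> z h - \<omega> h x)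
      + C * (\<omega> h x / 16 + \<omega> z h)"
    using prox_step subproblem_step error_step by linarith
  also have "\<dots> = C * (\<omega> y x - \<omega> y z - 15 / 16 * \<omega> h x)"
    by (simp add: algebra_simps)
  finally show ?thesis
    by (simp add: l_def C_def h_def z_def)
qed

text \<open>A vanishing divergence forces \<open>T x = x\<close>. The regularizer then disappears
  and the Taylor polynomial is \<open>F x\<close>, so the subproblem says that \<open>x\<close>
  solves the strong variational inequality; monotonicity passes from \<open>F x\<close> to
  \<open>F y\<close>.\<close>

lemma stopped_optimal:
  assumes x: "x \<in> X" and stop: "mvi_stops d gd p T x" and y: "y \<in> X"
  shows "F y \<bullet> (T x - y) \<le> 0"
proof -
  have "\<omega> (T x) x = 0"
    using stop unfolding mvi_stops_def omega_power_def by simp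
  then have "N (T x - x) \<le> 0"
    using norm_le_sqrt_bregman[OF sc T_in[OF x] x] by simp
  then have Tx: "T x = x"
    using is_norm_pos[OF N, of "T x - x"] by fastforce
  have "U_op X F d gd L p x (T x) \<bullet> (T x - y) \<le> 0"
    using T_solves x y unfolding subproblem_oracle_def by blast
  then have "F x \<bullet> (x - y) \<le> 0"
    by (simp add: Tx U_op_def taylor_self[OF x])
  moreover have "F y \<bullet> (x - y) \<le> F x \<bullet> (x - y)"
    using mono x y unfolding monotone_operator_def by (auto simp: inner_diff_left)
  ultimately show ?thesis
    by (simp add: Tx)
qed

section \<open>Iterates, telescoping and the iteration count\<close>

context
  fixes x0 :: 'a
  assumes x0: "x0 \<in> X"
begin

abbreviation "it \<equiv> mvi_iterate X F d gd L p T x0"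

lemma iterate_Suc:
  "it (Suc i) = (if mvi_stops d gd p T (it i) then it i else prox (it i))"
  by (simp add: Let_def prox_def)

lemma iterate_in: "it i \<in> X"
proof (induction i)
  case (Suc i)
  then show ?case
    using prox_in by (simp only: iterate_Suc split: if_splits) blast
qed (use x0 in simp)

text \<open>Read contrapositively: a run still active at index \<open>K\<close> was active at all
  earlier indices, so all its weights are genuine and positive.\<close>

lemma stops_mono:
  assumes "mvi_stops d gd p T (it i)" "i \<le> j"
  shows "mvi_stops d gd p T (it j)"
  using assms(2)
proof (induction rule: dec_induct)
  case (step n)
  then show ?case
    by (simp only: iterate_Suc if_True)
qed (use assms(1) in simp)

text \<open>Summing \<open>step\<close> telescopes the divergences from \<open>y\<close>; the last
  one is nonnegative and is dropped.\<close>

lemma sum_bound: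
  assumes run: "\<not> mvi_stops d gd p T (it K)" and y: "y \<in> X"
  shows "(\<Sum>i\<le>K. mvi_lambda d gd p T (it i) * (F y \<bullet> (T (it i) - y)))
    \<le> L / fact p * (\<omega> y x0 - 15 / 16 * (\<Sum>i\<le>K. \<omega> (T (it i)) (it i)))"
proof -
  have "(\<Sum>i\<le>K. mvi_lambda d gd p T (it i) * (F y \<bullet> (T (it i) - y)))
      \<le> (\<Sum>i\<le>K. L / fact p * (\<omega> y (it i) - \<omega> y (it (Suc i)) - 15 / 16 * \<omega> (T (it i)) (it i)))"
  proof (rule sum_mono)
    fix i assume "i \<in> {..K}"
    then have go: "\<not> mvi_stops d gd p T (it i)"
      using run stops_mono by blast
    show "mvi_lambda d gd p T (it i) * (F y \<bullet> (T (it i) - y))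
      \<le> L / fact p * (\<omega> y (it i) - \<omega> y (it (Suc i)) - 15 / 16 * \<omega> (T (it i)) (it i))"
      using step[OF iterate_in go y] go by (simp only: iterate_Suc if_False)
  qed
  also have "\<dots> = L / fact p * (\<omega> y x0 - \<omega> y (it (Suc K))
      - 15 / 16 * (\<Sum>i\<le>K. \<omega> (T (it i)) (it i)))"
    using sum_telescope[of "\<lambda>i. \<omega> y (it i)" K]
    by (simp only: sum_subtractf mvi_iterate.simps(1) flip: sum_distrib_left)
  also have "\<dots> \<le> L / fact p * (\<omega> y x0 - 15 / 16 * (\<Sum>i\<le>K. \<omega> (T (it i)) (it i)))"
    using L bregman_nonneg[OF sc y iterate_in, of "Suc K"] by (intro mult_left_mono) auto
  finally show ?thesis .
qed

lemma mvi_opt_bound: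
  assumes eps: "eps > 0" and y: "y \<in> X"
    and K: "16 / 15 * (2 * L / fact p) powr (2 / (real p + 1)) *
      (\<omega> y x0 / eps powr (2 / (real p + 1))) \<le> real (K + 1)"
  shows "F y \<bullet> (mvi_opt X F d gd L p T x0 K - y) \<le> eps"
proof (cases "mvi_stops d gd p T (it K)")
  case True
  then show ?thesis
    using stopped_optimal[OF iterate_in True y] eps by (simp add: mvi_opt_def)
next
  case run: False
  define C where "C = L / fact p"
  define w where "w i = \<omega> (T (it i)) (it i)" for i
  define l where "l i = mvi_lambda d gd p T (it i)" for i
  define \<Lambda> where "\<Lambda> = (\<Sum>i\<le>K. l i)"
  define gap where "gap = F y \<bullet> (mvi_opt X F d gd L p T x0 K - y)"
  \<comment> \<open>Chosen so that \<open>sqrt q ^ (p + 1) = 2 * C / eps\<close>. Its inverse is the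
    threshold for the mean of the \<open>w i\<close>, and the assumption on \<open>K\<close> becomes
    \<open>16 / 15 * \<omega> y x0 \<le> (K + 1) / q\<close>.\<close>
  define q where "q = (2 * C / eps) powr (2 / (real p + 1))"
  have C: "C > 0"
    using L by (simp add: C_def)
  have q: "q > 0"
    using C eps by (simp add: q_def)
  have go: "\<not> mvi_stops d gd p T (it i)" if "i \<le> K" for i
    using run stops_mono that by blast
  have l: "l i > 0" if "i \<le> K" for i
    using lambda_pos[OF iterate_in go[OF that]] by (simp add: l_def)
  have \<Lambda>: "\<Lambda> > 0"
    unfolding \<Lambda>_def by (rule sum_pos) (use l in auto)
  have "mvi_opt X F d gd L p T x0 K = (1 / \<Lambda>) *\<^sub>R (\<Sum>i\<le>K. l i *\<^sub>R T (it i))"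
    using run by (simp add: mvi_opt_def Let_def \<Lambda>_def l_def)
  then have "\<Lambda> *\<^sub>R (mvi_opt X F d gd L p T x0 K - y) = (\<Sum>i\<le>K. l i *\<^sub>R T (it i)) - \<Lambda> *\<^sub>R y"
    using \<Lambda> by (simp add: scaleR_diff_right)
  also have "\<dots> = (\<Sum>i\<le>K. l i *\<^sub>R (T (it i) - y))"
    by (simp add: \<Lambda>_def scaleR_diff_right sum_subtractf scaleR_left.sum)
  finally have "\<Lambda> * gap = F y \<bullet> (\<Sum>i\<le>K. l i *\<^sub>R (T (it i) - y))"
    by (metis gap_def inner_scaleR_right)
  also have "\<dots> \<le> C * (\<omega> y x0 - 15 / 16 * (\<Sum>i\<le>K. w i))"
    using sum_bound[OF run y] by (simp add: inner_sum_right C_def w_def l_def)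
  finally have gap: "\<Lambda> * gap \<le> C * (\<omega> y x0 - 15 / 16 * (\<Sum>i\<le>K. w i))" .
  have "q = (2 * L / fact p) powr (2 / (real p + 1)) / eps powr (2 / (real p + 1))"
    using L eps by (simp add: q_def C_def powr_divide powr_mult)
  then have "16 / 15 * \<omega> y x0 * q \<le> real (K + 1)"
    using K by (simp add: mult.commute mult.left_commute)
  then have D: "16 / 15 * \<omega> y x0 \<le> real (K + 1) / q"
    using q by (simp only: pos_le_divide_eq)
  have "\<Lambda> * gap \<le> \<Lambda> * eps"
  \<comment> \<open>Small mean movement makes the total weight \<open>\<Lambda>\<close> large; large
    mean movement makes the bound in \<open>gap\<close> nonpositive.\<close>
  proof (cases "(\<Sum>i\<le>K. w i) \<le> real (K + 1) / q")
    case True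
    \<comment> \<open>The index set \<open>{..K}\<close> has \<open>K + 1\<close> elements, one for
      each oracle call.\<close>
    have "real (K + 1) / sqrt (1 / q) ^ (p - 1) \<le> (\<Sum>i\<le>K. 1 / sqrt (w i) ^ (p - 1))"
      using sum_inverse_sqrt_power_ge[of "{..K}" w "p - 1" "1 / q"] True q go
      by (simp add: w_def omega_T_nonneg iterate_in mvi_stops_def omega_power_def)
    also have "\<dots> = 2 * \<Lambda>"
      by (simp add: \<Lambda>_def l_def w_def mvi_lambda_def omega_power_def sum_distrib_left)
    finally have \<Lambda>_ge: "real (K + 1) * sqrt q ^ (p - 1) \<le> 2 * \<Lambda>"
      by (simp add: real_sqrt_divide power_divide)
    have "sqrt q = (2 * C / eps) powr (1 / (real p + 1))"
      using q by (simp add: q_def powr_powr field_simps flip: powr_half_sqrt)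
    then have "sqrt q ^ (p + 1) = 2 * C / eps"
      using C eps powr_power[of "2 * C / eps" "1 / (real p + 1)" "p + 1"]
      by (simp add: add_divide_distrib[symmetric] add.commute[of 1 "real p"])
    moreover have "sqrt q ^ (p - 1) * q = sqrt q ^ (p + 1)"
      using p q by (cases p) (auto simp: power2_eq_square[symmetric] mult.commute)
    ultimately have q_eq: "C / q = eps * sqrt q ^ (p - 1) / 2"
      using q eps by (simp add: field_simps)
    have "0 \<le> w i" for i
      by (simp add: w_def omega_T_nonneg iterate_in)
    then have "0 \<le> (\<Sum>i\<le>K. w i)"
      by (intro sum_nonneg)
    then have "C * (\<omega> y x0 - 15 / 16 * (\<Sum>i\<le>K. w i)) \<le> C * \<omega> y x0"
      using C by (intro mult_left_mono) auto
    then have "\<Lambda> * gap \<le> C * \<omega> y x0"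
      using gap by linarith
    also have "\<dots> \<le> C * (real (K + 1) / q)"
      \<comment> \<open>Nonnegativity of the divergence lets the factor \<open>16 / 15\<close> in
        \<open>D\<close> be dropped.\<close>
      using D C bregman_nonneg[OF sc y x0] by (intro mult_left_mono) linarith+
    also have "\<dots> = eps / 2 * (real (K + 1) * sqrt q ^ (p - 1))"
      using arg_cong[OF q_eq, of "\<lambda>u. real (K + 1) * u"] by (simp add: field_simps)
    also have "\<dots> \<le> eps / 2 * (2 * \<Lambda>)"
      using \<Lambda>_ge eps by (intro mult_left_mono) auto
    finally show ?thesis
      by (simp add: mult.commute)
  next
    case False
    \<comment> \<open>Here \<open>16 / 15\<close> is used in full: the sum exceeds
      \<open>(K + 1) / q\<close>, hence \<open>16 / 15 * \<omega> y x0\<close>.\<close>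
    then have "C * (\<omega> y x0 - 15 / 16 * (\<Sum>i\<le>K. w i)) \<le> 0"
      using D C by (intro mult_nonneg_nonpos) linarith+
    then have "\<Lambda> * gap \<le> 0"
      using gap by linarith
    also have "\<dots> \<le> \<Lambda> * eps"
      using \<Lambda> eps by simp
    finally show ?thesis .
  qed
  then show ?thesis
    using \<Lambda> by (simp add: gap_def)
qed

end

end

theorem theorem3p3:
  fixes N :: "real ^ 'n \<Rightarrow> real"
    and X :: "(real ^ 'n) set"
    and F T gd :: "real ^ 'n \<Rightarrow> real ^ 'n"
    and d :: "real ^ 'n \<Rightarrow> real"
    and x0 :: "real ^ 'n"
    and L eps :: real
    and p :: nat
  assumes "eps > 0" and "p \<ge> 1" and "L > 0"
    and "closed X" and "convex X" and "x0 \<in> X"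
    and "is_norm N"
    and "monotone_operator X F" and "continuous_on X F" and "smooth_operator N X p L F"
    and "strongly_convex N X d gd"
    and "subproblem_oracle X F d gd L p T"
  shows "\<forall>x\<in>X. \<forall>K::nat.
           real (K + 1) \<ge> 16 / 15 * (2 * L / fact p) powr (2 / (real p + 1))
                           * (bregman d gd x x0 / eps powr (2 / (real p + 1)))
           \<longrightarrow> F x \<bullet> (mvi_opt X F d gd L p T x0 K - x) \<le> eps"
proof -
  interpret mvi N X F T gd d L p
    by unfold_locales (use assms in auto)
  show ?thesis
    using mvi_opt_bound[OF assms(6,1)] by blast
qed

end
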